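(* Let $r>0$ and let $\mathcal{C}^b(r)$ be the circle of radius $r$ centred at the origin and lying in the base plane. Then the (bounding surface of the) corresponding infinite fibre-like cylinder $\mathcal{C}^i(r)$ is, in the Euclidean sense, a one-sheeted hyperboloid with equation $$\frac{y^2}{\tanh^2 r}+\frac{z^2}{\tanh^2 r}-x^2=1,\qquad\text{where } x=\frac{x^1}{x^0},\ y=\frac{x^2}{x^0},\ z=\frac{x^3}{x^0}.$$
   Context: Projective model of $\widetilde{\mathbf{SL}_2\mathbf{R}}$: it is the universal cover of the solid $\mathcal{H}=\{(x^0;x^1;x^2;x^3): -x^0x^0-x^1x^1+x^2x^2+x^3x^3<0\}$ in projective space $\mathcal{P}^3$, with inhomogeneous Euclidean coordinates $x=x^1/x^0$, $y=x^2/x^0$, $z=x^3/x^0$ (for $x^0\neq0$) and origin $E_0=(1;0;0;0)$. The equation in the claim is understood in these inhomogeneous coordinates. Fibre translations $\mathbf{S}(\phi)$, $\phi\in\mathbf{R}$, act by $$(x^0;x^1;x^2;x^3)\mapsto(x^0\cos\phi-x^1\sin\phi;\ x^0\sin\phi+x^1\cos\phi;\ x^2\cos\phi+x^3\sin\phi;\ -x^2\sin\phi+x^3\cos\phi).$$ The fibre line through a point $X$ is the orbit of $X$ under all $\mathbf{S}(\phi)$. The base plane is the part of the plane $x=0$ lying in $\mathcal{H}$. Hyperboloid coordinates $(r,\theta,\phi)$ are given by $x^0=\cosh r\cos\phi$, $x^1=\cosh r\sin\phi$, $x^2=\sinh r\cos(\theta-\phi)$, $x^3=\sinh r\sin(\theta-\phi)$;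 the base plane is $\phi=0$. The circle $\mathcal{C}^b(r)$ of radius $r$ centred at the origin in the base plane consists of the points with coordinates $(r,\theta,0)$, i.e. $(1;0;\tanh r\cos\theta;\tanh r\sin\theta)$, $\theta\in(-\pi,\pi]$ ($r$ is the $\widetilde{\mathbf{SL}_2\mathbf{R}}$ geodesic distance from the origin). The infinite fibre-like cylinder $\mathcal{C}^i(r)$ is the infinite solid bounded by the surface formed by all fibre lines passing through the points of $\mathcal{C}^b(r)$. *)

theory Defs
  imports "HOL-Analysis.Analysis"
begin

section \<open>Projective 3-space\<close>

text \<open>The homogeneous coordinates \<open>x\<^sup>0, x\<^sup>1, x\<^sup>2, x\<^sup>3\<close> of the paper are the components
  \<open>v $ 0\<close>, \<open>v $ 1\<close>, \<open>v $ 2\<close>, \<open>v $ 3\<close> of a vector in \<open>real ^ 4\<close>. The four elements of the index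
  type \<open>4\<close> are \<open>0, 1, 2, 3\<close> (and \<open>4 = 0\<close>), so that the function \<open>vector\<close>, which starts at index
  \<open>1\<close>, would put \<open>x\<^sup>0\<close> in the last place; hence the following constructor.\<close>

definition hvec :: "real \<Rightarrow> real \<Rightarrow> real \<Rightarrow> real \<Rightarrow> real ^ 4" where
  "hvec a b c d = (\<chi> i. if i = 0 then a else if i = 1 then b else if i = 2 then c else d)"

lemma index_4_cases: "i = 0 \<or> i = 1 \<or> i = 2 \<or> i = (3::4)"
proof (induct i)
  case (of_int z)
  then have "z = 0 \<or> z = 1 \<or> z = 2 \<or> z = 3" by auto
  then show ?case by auto
qed

lemma hvec_nth [simp]:
  "hvec a b c d $ 0 = a" "hvec a b c d $ 1 = b" "hvec a b c d $ 2 = c" "hvec a b c d $ 3 = d"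
  by (simp_all add: hvec_def)

lemma hvec_eq_iff:
  "v = w \<longleftrightarrow> v $ 0 = w $ 0 \<and> v $ 1 = w $ 1 \<and> v $ 2 = w $ 2 \<and> v $ 3 = w $ 3" for v w :: "real ^ 4"
  unfolding vec_eq_iff using index_4_cases by metis

definition same_point :: "real ^ 4 \<Rightarrow> real ^ 4 \<Rightarrow> bool" where
  "same_point v w \<longleftrightarrow> v \<noteq> 0 \<and> w \<noteq> 0 \<and> (\<exists>c. c \<noteq> 0 \<and> w = c *\<^sub>R v)"

lemma same_point_refl: "v \<noteq> 0 \<Longrightarrow> same_point v v"
  unfolding same_point_def by (intro conjI exI[of _ 1]) auto

lemma same_point_sym: "same_point v w \<Longrightarrow> same_point w v"
  unfolding same_point_def by (metis inverse_nonzero_iff_nonzero scaleR_scaleR left_inverse scaleR_one)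

lemma same_point_trans: "same_point u v \<Longrightarrow> same_point v w \<Longrightarrow> same_point u w"
  unfolding same_point_def by (metis mult_eq_0_iff scaleR_scaleR)

quotient_type proj3 = "real ^ 4" / partial: same_point
proof (rule part_equivpI)
  have "hvec 1 0 0 0 \<noteq> 0" by (simp add: hvec_eq_iff)
  then show "\<exists>v. same_point v v" by (blast intro: same_point_refl)
  show "symp same_point" by (blast intro: sympI same_point_sym)
  show "transp same_point" by (blast intro: transpI same_point_trans)
qed

text \<open>The point with homogeneous coordinates \<open>v\<close>; only meaningful for \<open>v \<noteq> 0\<close>.\<close>

definition point :: "real ^ 4 \<Rightarrow> proj3" where
  "point v = abs_proj3 v"

text \<open>The quotient topology of \<open>\<real>\<^sup>4 - {0}\<close>.\<close>

instantiation proj3 :: topological_space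
begin

definition open_proj3 :: "proj3 set \<Rightarrow> bool" where
  "open_proj3 U \<longleftrightarrow> open {v. v \<noteq> 0 \<and> point v \<in> U}"

instance
proof
  have "{v :: real ^ 4. v \<noteq> 0} = - {0}" by auto
  then show "open (UNIV :: proj3 set)" by (simp add: open_proj3_def open_Compl)
next
  fix S T :: "proj3 set"
  assume "open S" "open T"
  moreover have "{v. v \<noteq> 0 \<and> point v \<in> S \<inter> T}
      = {v. v \<noteq> 0 \<and> point v \<in> S} \<inter> {v. v \<noteq> 0 \<and> point v \<in> T}" by auto
  ultimately show "open (S \<inter> T)" by (simp add: open_proj3_def open_Int)
next
  fix K :: "proj3 set set"
  assume "\<forall>S\<in>K. open S"
  moreover have "{v. v \<noteq> 0 \<and> point v \<in> \<Union>K} = (\<Union>S\<in>K. {v. v \<noteq> 0 \<and> point v \<in> S})" by auto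
  ultimately show "open (\<Union>K)" by (auto simp: open_proj3_def)
qed

end

lift_definition proper :: "proj3 \<Rightarrow> bool" is "\<lambda>v. v $ 0 \<noteq> 0"
  by (auto simp: same_point_def)

text \<open>The inhomogeneous Euclidean coordinates \<open>(x, y, z)\<close>; only meaningful for proper points.\<close>

lift_definition inhom :: "proj3 \<Rightarrow> real ^ 3" is
  "\<lambda>v. vector [v $ 1 / v $ 0, v $ 2 / v $ 0, v $ 3 / v $ 0]"
  by (auto simp: same_point_def)


section \<open>The solid, the base plane and the fibre translations\<close>

definition solid :: "proj3 set" where
  "solid = point ` {v. - (v $ 0 * v $ 0) - v $ 1 * v $ 1 + v $ 2 * v $ 2 + v $ 3 * v $ 3 < 0}"

definition origin :: proj3 where
  "origin = point (hvec 1 0 0 0)"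

text \<open>The plane \<open>x = 0\<close> is \<open>x\<^sup>1 = 0\<close> in homogeneous coordinates; inside the solid it has no points
  at infinity.\<close>

definition base_plane :: "proj3 set" where
  "base_plane = solid \<inter> point ` {v. v \<noteq> 0 \<and> v $ 1 = 0}"

definition fibre_matrix :: "real \<Rightarrow> real ^ 4 \<Rightarrow> real ^ 4" where
  "fibre_matrix \<phi> v = hvec
     (v $ 0 * cos \<phi> - v $ 1 * sin \<phi>)
     (v $ 0 * sin \<phi> + v $ 1 * cos \<phi>)
     (v $ 2 * cos \<phi> + v $ 3 * sin \<phi>)
     (- (v $ 2) * sin \<phi> + v $ 3 * cos \<phi>)"

lemma fibre_matrix_scaleR: "fibre_matrix \<phi> (c *\<^sub>R v) = c *\<^sub>R fibre_matrix \<phi> v"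
  by (simp add: hvec_eq_iff fibre_matrix_def algebra_simps)

lemma fibre_matrix_inverse: "fibre_matrix (- \<phi>) (fibre_matrix \<phi> v) = v"
proof -
  note trig = sin_cos_squared_add3[of \<phi>]
  have "(a * cos \<phi> - b * sin \<phi>) * cos \<phi> + (a * sin \<phi> + b * cos \<phi>) * sin \<phi> = a"
    "(a * sin \<phi> + b * cos \<phi>) * cos \<phi> - (a * cos \<phi> - b * sin \<phi>) * sin \<phi> = b"
    "(a * cos \<phi> + b * sin \<phi>) * cos \<phi> - (b * cos \<phi> - a * sin \<phi>) * sin \<phi> = a"
    "(b * cos \<phi> - a * sin \<phi>) * cos \<phi> - (- (a * cos \<phi>) - b * sin \<phi>) * sin \<phi> = b" for a b
    using trig by algebra+
  then show ?thesis
    by (simp add: hvec_eq_iff fibre_matrix_def)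
qed

lemma fibre_matrix_nonzero: "v \<noteq> 0 \<Longrightarrow> fibre_matrix \<phi> v \<noteq> 0"
  by (metis fibre_matrix_inverse fibre_matrix_scaleR scale_zero_left)

lift_definition fibre_translation :: "real \<Rightarrow> proj3 \<Rightarrow> proj3" is fibre_matrix
  by (auto simp: same_point_def fibre_matrix_scaleR fibre_matrix_nonzero)

definition hyperboloid_point :: "real \<Rightarrow> real \<Rightarrow> real \<Rightarrow> proj3" where
  "hyperboloid_point r \<theta> \<phi> = point (hvec
     (cosh r * cos \<phi>) (cosh r * sin \<phi>) (sinh r * cos (\<theta> - \<phi>)) (sinh r * sin (\<theta> - \<phi>)))"


section \<open>The universal cover of the solid\<close>

text \<open>The universal cover is the usual path space model: its points are the homotopy classes, with
  fixed end points, of paths in the solid that start at \<open>origin\<close>, and the covering map sends a class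
  to the common end point of its paths.\<close>

definition path_class :: "(real \<Rightarrow> proj3) \<Rightarrow> (real \<Rightarrow> proj3) set" where
  "path_class \<gamma> = {\<delta>. homotopic_paths solid \<gamma> \<delta>}"

definition universal_cover :: "(real \<Rightarrow> proj3) set set" where
  "universal_cover = path_class ` {\<gamma>. path \<gamma> \<and> path_image \<gamma> \<subseteq> solid \<and> pathstart \<gamma> = origin}"

definition covering_map :: "(real \<Rightarrow> proj3) set \<Rightarrow> proj3" where
  "covering_map X = the_elem (pathfinish ` X)"

text \<open>The fibre translations act on the universal cover by lifting: the flow line of \<open>X\<close> is the lift,
  starting at \<open>X\<close>, of the flow line of \<open>covering_map X\<close>. In the path space model this lift prolongs
  the paths in \<open>X\<close> along the flow. Here \<open>\<phi>\<close> and \<open>\<phi> + pi\<close> act differently,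
  whereas they act alike on projective space.\<close>

definition flow_path :: "real \<Rightarrow> proj3 \<Rightarrow> real \<Rightarrow> proj3" where
  "flow_path \<phi> P = (\<lambda>t. fibre_translation (t * \<phi>) P)"

definition cover_translation :: "real \<Rightarrow> (real \<Rightarrow> proj3) set \<Rightarrow> (real \<Rightarrow> proj3) set" where
  "cover_translation \<phi> X =
     {\<delta>. \<exists>\<gamma>\<in>X. homotopic_paths solid (\<gamma> +++ flow_path \<phi> (pathfinish \<gamma>)) \<delta>}"

definition fibre_line :: "(real \<Rightarrow> proj3) set \<Rightarrow> (real \<Rightarrow> proj3) set set" where
  "fibre_line X = range (\<lambda>\<phi>. cover_translation \<phi> X)"

text \<open>The base plane of the cover is the sheet over \<open>base_plane\<close> through the class of the constant
  path at \<open>origin\<close>.\<close>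

definition cover_base_plane :: "(real \<Rightarrow> proj3) set set" where
  "cover_base_plane = {X \<in> universal_cover. \<exists>\<gamma>\<in>X. path_image \<gamma> \<subseteq> base_plane}"

definition base_circle :: "real \<Rightarrow> (real \<Rightarrow> proj3) set set" where
  "base_circle r =
     {X \<in> cover_base_plane. \<exists>\<theta>\<in>{-pi<..pi}. covering_map X = hyperboloid_point r \<theta> 0}"

text \<open>The bounding surface of the infinite fibre-like cylinder of radius \<open>r\<close>.\<close>

definition cylinder_surface :: "real \<Rightarrow> (real \<Rightarrow> proj3) set set" where
  "cylinder_surface r = (\<Union>X\<in>base_circle r. fibre_line X)"

definition euclidean_points :: "(real \<Rightarrow> proj3) set set \<Rightarrow> (real ^ 3) set" where
  "euclidean_points A = inhom ` {P \<in> covering_map ` A. proper P}"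

text \<open>One-sheeted hyperboloids are the sets congruent to one in normal form.\<close>

definition one_sheeted_hyperboloid :: "(real ^ 3) set \<Rightarrow> bool" where
  "one_sheeted_hyperboloid S \<longleftrightarrow>
     (\<exists>a>0. \<exists>b>0. \<exists>c>0. \<exists>f :: real ^ 3 \<Rightarrow> real ^ 3.
        (\<forall>p q. dist (f p) (f q) = dist p q) \<and>
        S = f ` {p. (p $ 1)\<^sup>2 / a\<^sup>2 + (p $ 2)\<^sup>2 / b\<^sup>2 - (p $ 3)\<^sup>2 / c\<^sup>2 = 1})"

end

theory Submission
  imports Defs
begin

text \<open>The covering map intertwines the fibre translations of the universal cover with those of the
  projective solid. Hence the cylinder surface lies over the points
  \<open>(cosh r cos \<phi>; cosh r sin \<phi>; sinh r cos (\<theta> - \<phi>); sinh r sin (\<theta> - \<phi>))\<close>, which have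
  \<open>x = tan \<phi>\<close> and \<open>y\<^sup>2 + z\<^sup>2 = tanh\<^sup>2 r / cos\<^sup>2 \<phi> = tanh\<^sup>2 r (1 + x\<^sup>2)\<close>. Conversely, a point of the
  hyperboloid determines \<open>\<phi> = arctan x\<close>, and \<open>\<theta> - \<phi>\<close> as a polar angle of \<open>(y, z)\<close>.\<close>

section \<open>Continuity and coordinates through homogeneous representatives\<close>

lemma continuous_on_hvec:
  assumes "continuous_on S f" "continuous_on S g" "continuous_on S h" "continuous_on S k"
  shows "continuous_on S (\<lambda>t. hvec (f t) (g t) (h t) (k t))"
  unfolding hvec_def
proof (rule continuous_on_vec_lambda)
  fix i :: 4
  show "continuous_on S (\<lambda>t. if i = 0 then f t else if i = 1 then g t else if i = 2 then h t else k t)"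
    using assms by (cases "i = 0"; cases "i = 1"; cases "i = 2") simp_all
qed

text \<open>Open sets of \<open>proj3\<close> are those whose preimage among the nonzero vectors is
  open, so pulling one back along the curve of points amounts to pulling back an open set of vectors
  along \<open>g\<close>. This yields continuity of paths in the solid from that of their
  representatives.\<close>

lemma continuous_on_point:
  assumes "continuous_on S g" "\<And>t. t \<in> S \<Longrightarrow> g t \<noteq> 0"
  shows "continuous_on S (\<lambda>t. point (g t))"
  unfolding continuous_on_open_invariant
proof (intro allI impI)
  fix U :: "proj3 set"
  assume "open U"
  then have "open {v. v \<noteq> 0 \<and> point v \<in> U}"
    by (simp add: open_proj3_def)
  then obtain A where A: "open A" "A \<inter> S = g -` {v. v \<noteq> 0 \<and> point v \<in> U} \<inter> S"
    using assms(1) unfolding continuous_on_open_invariant by meson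
  moreover have "g -` {v. v \<noteq> 0 \<and> point v \<in> U} \<inter> S = (\<lambda>t. point (g t)) -` U \<inter> S"
    using assms(2) by auto
  ultimately show "\<exists>A. open A \<and> A \<inter> S = (\<lambda>t. point (g t)) -` U \<inter> S"
    by auto
qed

lemma fibre_translation_point:
  "v \<noteq> 0 \<Longrightarrow> fibre_translation \<phi> (point v) = point (fibre_matrix \<phi> v)"
  by (simp add: point_def fibre_translation.abs_eq same_point_refl)

lemma proper_point: "v \<noteq> 0 \<Longrightarrow> proper (point v) \<longleftrightarrow> v $ 0 \<noteq> 0"
  by (simp add: point_def proper.abs_eq same_point_refl)

lemma inhom_point:
  "v \<noteq> 0 \<Longrightarrow> inhom (point v) = vector [v $ 1 / v $ 0, v $ 2 / v $ 0, v $ 3 / v $ 0]"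
  by (simp add: point_def inhom.abs_eq same_point_refl)

section \<open>The quadratic form of signature (2,2) and its invariance under the flow\<close>

definition solid_form :: "real ^ 4 \<Rightarrow> real" where
  "solid_form v = - (v $ 0 * v $ 0) - v $ 1 * v $ 1 + v $ 2 * v $ 2 + v $ 3 * v $ 3"

text \<open>The matrix rotates the first two coordinates by \<phi> and the last two by -\<phi>,
  hence preserves the Euclidean norm of each pair.\<close>

lemma solid_form_fibre_matrix: "solid_form (fibre_matrix \<phi> v) = solid_form v"
  unfolding solid_form_def fibre_matrix_def hvec_nth
  using sin_cos_squared_add3[of \<phi>] by algebra

lemma solidE:
  assumes "P \<in> solid"
  obtains v where "P = point v" "v \<noteq> 0" "solid_form v < 0"
proof -
  obtain v where v: "P = point v" "solid_form v < 0"
    using assms by (auto simp: solid_def solid_form_def)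
  moreover have "v \<noteq> 0"
    using v(2) by (auto simp: solid_form_def)
  ultimately show thesis
    using that by blast
qed

lemma point_in_solid: "solid_form v < 0 \<Longrightarrow> point v \<in> solid"
  by (auto simp: solid_def solid_form_def)

text \<open>The orbit stays in the solid by invariance of the form, so a path in the solid may be
  prolonged along it without leaving the solid.\<close>

lemma flow_path:
  assumes "P \<in> solid"
  shows "path (flow_path \<phi> P)" "path_image (flow_path \<phi> P) \<subseteq> solid"
    "pathstart (flow_path \<phi> P) = P" "pathfinish (flow_path \<phi> P) = fibre_translation \<phi> P"
proof -
  obtain v where v: "P = point v" "v \<noteq> 0" "solid_form v < 0"
    using assms by (rule solidE)
  have eq: "flow_path \<phi> P = (\<lambda>t. point (fibre_matrix (t * \<phi>) v))"
    using v by (simp add: flow_path_def fibre_translation_point)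
  show "path (flow_path \<phi> P)"
    unfolding eq path_def
  proof (rule continuous_on_point)
    show "continuous_on {0..1} (\<lambda>t. fibre_matrix (t * \<phi>) v)"
      unfolding fibre_matrix_def by (intro continuous_on_hvec continuous_intros)
  qed (use v fibre_matrix_nonzero in blast)
  show "path_image (flow_path \<phi> P) \<subseteq> solid"
    using v(3) by (auto simp: eq path_image_def solid_form_fibre_matrix intro!: point_in_solid)
  have "fibre_matrix 0 v = v"
    by (simp add: hvec_eq_iff fibre_matrix_def)
  then show "pathstart (flow_path \<phi> P) = P"
    unfolding eq pathstart_def using v(1) by simp
  show "pathfinish (flow_path \<phi> P) = fibre_translation \<phi> P"
    by (simp add: flow_path_def pathfinish_def)
qed

section \<open>End points of homotopy classes\<close>

lemma covering_map_eqI: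
  assumes "\<gamma> \<in> X" "\<And>\<delta>. \<delta> \<in> X \<Longrightarrow> pathfinish \<delta> = P"
  shows "covering_map X = P"
proof -
  have "pathfinish ` X = {P}"
    using assms by blast
  then show ?thesis
    by (simp add: covering_map_def)
qed

text \<open>Homotopies in \<open>homotopic_paths\<close> fix the end points, so the paths of the
  class have a single common end point and \<open>the_elem\<close> is determined.\<close>

lemma covering_map_path_class:
  assumes "path \<gamma>" "path_image \<gamma> \<subseteq> solid"
  shows "covering_map (path_class \<gamma>) = pathfinish \<gamma>"
  by (rule covering_map_eqI[of \<gamma>])
    (use assms in \<open>auto simp: path_class_def dest: homotopic_paths_imp_pathfinish\<close>)

text \<open>Prolonging \<gamma> by its flow line moves the end point to its translate. Another
  representative \<beta> of the class has the same end point, hence is prolonged by the same flow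
  line.\<close>

lemma covering_map_cover_translation:
  assumes "X \<in> universal_cover"
  shows "covering_map (cover_translation \<phi> X) = fibre_translation \<phi> (covering_map X)"
proof -
  obtain \<gamma> where X: "X = path_class \<gamma>" and \<gamma>: "path \<gamma>" "path_image \<gamma> \<subseteq> solid"
    using assms by (auto simp: universal_cover_def)
  define \<epsilon> where "\<epsilon> = \<gamma> +++ flow_path \<phi> (pathfinish \<gamma>)"
  have "pathfinish \<gamma> \<in> solid"
    using \<gamma> by blast
  then have "path \<epsilon>" "path_image \<epsilon> \<subseteq> solid"
    using \<gamma> flow_path[of "pathfinish \<gamma>" \<phi>] by (auto simp: \<epsilon>_def subset_path_image_join)
  then have \<epsilon>: "\<epsilon> \<in> cover_translation \<phi> X"
    using \<gamma> by (auto simp: cover_translation_def X path_class_def \<epsilon>_def intro!: exI[of _ \<gamma>])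
  have "pathfinish \<delta> = fibre_translation \<phi> (pathfinish \<gamma>)" if \<delta>: "\<delta> \<in> cover_translation \<phi> X" for \<delta>
  proof -
    obtain \<beta> where "homotopic_paths solid \<gamma> \<beta>"
      "homotopic_paths solid (\<beta> +++ flow_path \<phi> (pathfinish \<beta>)) \<delta>"
      using \<delta> by (auto simp: cover_translation_def X path_class_def)
    then have "pathfinish \<beta> = pathfinish \<gamma>" "pathfinish \<delta> = pathfinish (flow_path \<phi> (pathfinish \<beta>))"
      by (auto dest: homotopic_paths_imp_pathfinish)
    then show ?thesis
      using flow_path(4)[OF \<open>pathfinish \<gamma> \<in> solid\<close>] by simp
  qed
  then have "covering_map (cover_translation \<phi> X) = fibre_translation \<phi> (pathfinish \<gamma>)"
    by (intro covering_map_eqI[OF \<epsilon>])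
  then show ?thesis
    using \<gamma> by (simp add: X covering_map_path_class)
qed

section \<open>Circle and cylinder in hyperboloid coordinates\<close>

lemma hyperboloid_point_rep_nonzero:
  "hvec (cosh r * cos \<phi>) (cosh r * sin \<phi>) (sinh r * cos \<theta>) (sinh r * sin \<theta>) \<noteq> 0"
proof
  assume "hvec (cosh r * cos \<phi>) (cosh r * sin \<phi>) (sinh r * cos \<theta>) (sinh r * sin \<theta>) = 0"
  \<comment> \<open>The factor \<open>cosh r\<close> is positive and cancels.\<close>
  then have "cos \<phi> = 0" "sin \<phi> = 0"
    by (auto simp: hvec_eq_iff)
  then show False
    using sin_cos_squared_add3[of \<phi>] by simp
qed

lemma hyperboloid_point_in_base_plane: "hyperboloid_point r \<theta> 0 \<in> base_plane"
proof -
  define v where "v = hvec (cosh r * cos 0) (cosh r * sin 0) (sinh r * cos \<theta>) (sinh r * sin \<theta>)"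
  \<comment> \<open>In this shape the two Pythagorean identities give the value -1.\<close>
  have "solid_form v = (sinh r)\<^sup>2 * ((sin \<theta>)\<^sup>2 + (cos \<theta>)\<^sup>2) - (cosh r)\<^sup>2"
    unfolding solid_form_def v_def hvec_nth cos_zero sin_zero by algebra
  then have "solid_form v < 0"
    by (simp add: cosh_square_eq)
  moreover have "v \<noteq> 0" "v $ 1 = 0"
    unfolding v_def by (rule hyperboloid_point_rep_nonzero) simp
  ultimately have "point v \<in> base_plane"
    unfolding base_plane_def by (auto intro: point_in_solid)
  then show ?thesis
    by (simp add: hyperboloid_point_def v_def)
qed

text \<open>The task is to lift each point of the circle to the sheet
  \<open>cover_base_plane\<close>, which requires a path from the origin inside the base
  plane.\<close>

lemma covering_map_base_circle:
  "covering_map ` base_circle r = (\<lambda>\<theta>. hyperboloid_point r \<theta> 0) ` {-pi<..pi}"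
proof
  show "covering_map ` base_circle r \<subseteq> (\<lambda>\<theta>. hyperboloid_point r \<theta> 0) ` {-pi<..pi}"
    by (auto simp: base_circle_def)
next
  show "(\<lambda>\<theta>. hyperboloid_point r \<theta> 0) ` {-pi<..pi} \<subseteq> covering_map ` base_circle r"
  proof
    fix P
    assume "P \<in> (\<lambda>\<theta>. hyperboloid_point r \<theta> 0) ` {-pi<..pi}"
    then obtain \<theta> where \<theta>: "\<theta> \<in> {-pi<..pi}" and P: "P = hyperboloid_point r \<theta> 0"
      by auto
    \<comment> \<open>The radial path with fixed angle; at t = 0 it is at \<open>origin\<close>,
      since \<open>sinh 0 = 0\<close>.\<close>
    define \<gamma> where "\<gamma> = (\<lambda>t. hyperboloid_point (t * r) \<theta> 0)"
    have "path \<gamma>"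
      unfolding path_def \<gamma>_def hyperboloid_point_def
      by (intro continuous_on_point continuous_on_hvec continuous_intros
          hyperboloid_point_rep_nonzero)
    moreover have image: "path_image \<gamma> \<subseteq> base_plane"
      by (auto simp: path_image_def \<gamma>_def hyperboloid_point_in_base_plane)
    moreover have solid: "path_image \<gamma> \<subseteq> solid"
      using image by (auto simp: base_plane_def)
    moreover have "pathstart \<gamma> = origin"
      by (simp add: pathstart_def \<gamma>_def hyperboloid_point_def origin_def)
    ultimately have "path_class \<gamma> \<in> cover_base_plane"
      by (auto simp: cover_base_plane_def universal_cover_def path_class_def intro!: exI[of _ \<gamma>])
    moreover have cov: "covering_map (path_class \<gamma>) = P"
      using covering_map_path_class[OF \<open>path \<gamma>\<close> solid] by (simp add: pathfinish_def \<gamma>_def P)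
    ultimately have "path_class \<gamma> \<in> base_circle r"
      using \<theta> by (auto simp: base_circle_def P)
    then show "P \<in> covering_map ` base_circle r"
      using cov by blast
  qed
qed

text \<open>By the addition formulas the translation changes the fibre coordinate and keeps r and
  \<theta>; this is why the last two coordinates contain \<theta> - \<phi>.\<close>

lemma fibre_translation_hyperboloid_point:
  "fibre_translation \<phi> (hyperboloid_point r \<theta> 0) = hyperboloid_point r \<theta> \<phi>"
proof -
  have "fibre_translation \<phi> (hyperboloid_point r \<theta> 0) =
      point (fibre_matrix \<phi> (hvec (cosh r * cos 0) (cosh r * sin 0) (sinh r * cos (\<theta> - 0)) (sinh r * sin (\<theta> - 0))))"
    unfolding hyperboloid_point_def
    by (rule fibre_translation_point[OF hyperboloid_point_rep_nonzero])
  also have "\<dots> = hyperboloid_point r \<theta> \<phi>"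
    unfolding hyperboloid_point_def
    by (rule arg_cong[of _ _ point])
      (simp add: hvec_eq_iff fibre_matrix_def cos_diff sin_diff algebra_simps)
  finally show ?thesis .
qed

lemma covering_map_cylinder_surface:
  "covering_map ` cylinder_surface r = {hyperboloid_point r \<theta> \<phi> |\<theta> \<phi>. \<theta> \<in> {-pi<..pi}}"
proof -
  have "base_circle r \<subseteq> universal_cover"
    by (auto simp: base_circle_def cover_base_plane_def)
  then have "covering_map ` cylinder_surface r =
      (\<Union>X\<in>base_circle r. range (\<lambda>\<phi>. fibre_translation \<phi> (covering_map X)))"
    by (auto simp: cylinder_surface_def fibre_line_def image_UN image_image
        covering_map_cover_translation subset_iff)
  also have "\<dots> = (\<Union>P\<in>covering_map ` base_circle r. range (\<lambda>\<phi>. fibre_translation \<phi> P))"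
    by simp
  also have "\<dots> = {hyperboloid_point r \<theta> \<phi> |\<theta> \<phi>. \<theta> \<in> {-pi<..pi}}"
    unfolding covering_map_base_circle by (auto simp: fibre_translation_hyperboloid_point)
  finally show ?thesis .
qed

section \<open>Inhomogeneous coordinates and the hyperboloid equation\<close>

lemma proper_hyperboloid_point: "proper (hyperboloid_point r \<theta> \<phi>) \<longleftrightarrow> cos \<phi> \<noteq> 0"
  by (simp add: hyperboloid_point_def proper_point hyperboloid_point_rep_nonzero)

lemma inhom_hyperboloid_point:
  "inhom (hyperboloid_point r \<theta> \<phi>) =
     vector [tan \<phi>, tanh r * (cos (\<theta> - \<phi>) / cos \<phi>), tanh r * (sin (\<theta> - \<phi>) / cos \<phi>)]"
  by (simp add: hyperboloid_point_def inhom_point hyperboloid_point_rep_nonzero tan_def tanh_def)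

text \<open>A polar angle of (a, b) increased by \<phi> may leave the range of \<theta>. Rotating
  the unit vector by \<phi> first and then taking its principal argument \<open>Arg\<close> keeps
  \<theta> in range.\<close>

lemma polar_angle_shift:
  fixes a b \<phi> :: real
  assumes "a\<^sup>2 + b\<^sup>2 = 1"
  obtains \<theta> where "\<theta> \<in> {-pi<..pi}" "cos (\<theta> - \<phi>) = a" "sin (\<theta> - \<phi>) = b"
proof -
  define w where "w = cis \<phi> * Complex a b"
  have "cmod w = 1"
    using assms by (simp add: w_def norm_mult complex_norm)
  then have "cis (Arg w) = w"
    using rcis_cmod_Arg[of w] by (simp add: rcis_def)
  then have "cis (Arg w - \<phi>) = Complex a b"
    by (simp add: w_def flip: cis_divide)
  then have "cos (Arg w - \<phi>) = a" "sin (Arg w - \<phi>) = b"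
    by (simp_all add: complex_eq_iff)
  moreover have "Arg w \<in> {-pi<..pi}"
    using Arg_bounded[of w] by simp
  ultimately show thesis
    using that by blast
qed

lemma euclidean_points_cylinder_surface:
  fixes r :: real
  assumes "r > 0"
  shows "euclidean_points (cylinder_surface r) =
    {vector [x, y, z] | x y z. y\<^sup>2 / (tanh r)\<^sup>2 + z\<^sup>2 / (tanh r)\<^sup>2 - x\<^sup>2 = 1}" (is "?E = ?H")
proof
  have T: "tanh r > 0"
    using assms by simp
  show "?E \<subseteq> ?H"
  proof
    fix p
    assume "p \<in> ?E"
    then obtain \<theta> \<phi> where p: "p = inhom (hyperboloid_point r \<theta> \<phi>)" and c: "cos \<phi> \<noteq> 0"
      unfolding euclidean_points_def covering_map_cylinder_surface
      by (auto simp: proper_hyperboloid_point)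
    have "(tanh r * (cos (\<theta> - \<phi>) / cos \<phi>))\<^sup>2 / (tanh r)\<^sup>2 + (tanh r * (sin (\<theta> - \<phi>) / cos \<phi>))\<^sup>2 / (tanh r)\<^sup>2
        - (tan \<phi>)\<^sup>2 = ((cos (\<theta> - \<phi>))\<^sup>2 + (sin (\<theta> - \<phi>))\<^sup>2 - (sin \<phi>)\<^sup>2) / (cos \<phi>)\<^sup>2"
      unfolding tan_def power_mult_distrib power_divide add_divide_distrib diff_divide_distrib
      using T by simp
    \<comment> \<open>The numerator is 1 - sin^2 \<phi> = cos^2 \<phi>.\<close>
    also have "\<dots> = 1"
      using c by (simp add: sin_squared_eq)
    finally show "p \<in> ?H"
      unfolding p inhom_hyperboloid_point by blast
  qed
  show "?H \<subseteq> ?E"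
  proof
    fix p
    assume "p \<in> ?H"
    then obtain x y z where p: "p = vector [x, y, z]"
      and eq: "y\<^sup>2 / (tanh r)\<^sup>2 + z\<^sup>2 / (tanh r)\<^sup>2 - x\<^sup>2 = 1"
      by blast
    \<comment> \<open>This branch makes \<open>cos \<phi>\<close> positive, so the point found is
      proper.\<close>
    define \<phi> where "\<phi> = arctan x"
    have c: "cos \<phi> > 0"
      unfolding \<phi>_def by (rule cos_gt_zero_pi[OF arctan_lbound arctan_ubound])
    have x: "tan \<phi> = x"
      unfolding \<phi>_def by (rule tan_arctan)
    have sec: "(cos \<phi>)\<^sup>2 * (1 + x\<^sup>2) = 1"
      by (simp add: \<phi>_def cos_arctan power_divide add_nonneg_eq_0_iff)
    \<comment> \<open>The values that \<theta> - \<phi> must have as cosine and sine come from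
      solving the coordinate formulas for y and z; the hyperboloid equation puts them on the unit
      circle.\<close>
    have "(y * cos \<phi> / tanh r)\<^sup>2 + (z * cos \<phi> / tanh r)\<^sup>2
        = (cos \<phi>)\<^sup>2 * (y\<^sup>2 / (tanh r)\<^sup>2 + z\<^sup>2 / (tanh r)\<^sup>2)"
      by (simp add: power_mult_distrib power_divide algebra_simps)
    also have "\<dots> = 1"
      using eq sec by (simp add: algebra_simps)
    finally obtain \<theta> where \<theta>: "\<theta> \<in> {-pi<..pi}" "cos (\<theta> - \<phi>) = y * cos \<phi> / tanh r"
      "sin (\<theta> - \<phi>) = z * cos \<phi> / tanh r"
      by (rule polar_angle_shift)
    have "inhom (hyperboloid_point r \<theta> \<phi>) = p"
      using T c by (simp add: inhom_hyperboloid_point \<theta> x p)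
    moreover have "hyperboloid_point r \<theta> \<phi> \<in> {P \<in> covering_map ` cylinder_surface r. proper P}"
      using \<theta>(1) c by (auto simp: covering_map_cylinder_surface proper_hyperboloid_point)
    ultimately show "p \<in> ?E"
      unfolding euclidean_points_def by blast
  qed
qed

text \<open>The normal form has its axis along the third coordinate, the cylinder along the first. A
  cyclic permutation of the coordinates is an isometry taking one to the other.\<close>

lemma one_sheeted_hyperboloid_first_axis:
  fixes a b c :: real
  assumes "a > 0" "b > 0" "c > 0"
  shows "one_sheeted_hyperboloid {vector [x, y, z] | x y z. y\<^sup>2 / a\<^sup>2 + z\<^sup>2 / b\<^sup>2 - x\<^sup>2 / c\<^sup>2 = 1}"
    (is "one_sheeted_hyperboloid ?H")
proof -
  define f :: "real ^ 3 \<Rightarrow> real ^ 3" where "f p = vector [p $ 3, p $ 1, p $ 2]" for p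
  have "dist (f p) (f q) = dist p q" for p q
    by (simp add: f_def dist_vec_def L2_set_def sum_3 add_ac)
  moreover have "?H = f ` {p. (p $ 1)\<^sup>2 / a\<^sup>2 + (p $ 2)\<^sup>2 / b\<^sup>2 - (p $ 3)\<^sup>2 / c\<^sup>2 = 1}"
  proof
    show "?H \<subseteq> f ` {p. (p $ 1)\<^sup>2 / a\<^sup>2 + (p $ 2)\<^sup>2 / b\<^sup>2 - (p $ 3)\<^sup>2 / c\<^sup>2 = 1}"
    proof
      fix p
      assume "p \<in> ?H"
      then obtain x y z where "p = vector [x, y, z]" "y\<^sup>2 / a\<^sup>2 + z\<^sup>2 / b\<^sup>2 - x\<^sup>2 / c\<^sup>2 = 1"
        by blast
      then show "p \<in> f ` {p. (p $ 1)\<^sup>2 / a\<^sup>2 + (p $ 2)\<^sup>2 / b\<^sup>2 - (p $ 3)\<^sup>2 / c\<^sup>2 = 1}"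
        by (intro image_eqI[of _ _ "vector [y, z, x]"]) (simp_all add: f_def)
    qed
  qed (unfold f_def, blast)
  ultimately show ?thesis
    using assms unfolding one_sheeted_hyperboloid_def by blast
qed

theorem lemma4p1:
  fixes r :: real
  assumes "r > 0"
  shows "one_sheeted_hyperboloid (euclidean_points (cylinder_surface r)) \<and>
    euclidean_points (cylinder_surface r) =
      {vector [x, y, z] | x y z. y\<^sup>2 / (tanh r)\<^sup>2 + z\<^sup>2 / (tanh r)\<^sup>2 - x\<^sup>2 = 1}"
  \<comment> \<open>The semi-axis 1 along x accounts for the bare term x^2 in the equation.\<close>
  using euclidean_points_cylinder_surface[OF assms]
    one_sheeted_hyperboloid_first_axis[of "tanh r" "tanh r" 1] assms
  by simp

end
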